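(* Let $\Omega\subset\mathbb{R}^d$, $d\in\{2,3\}$, be a bounded convex domain with polygonal or polyhedral boundary, let $V=H^1_0(\Omega)$ and $\mathbf{Q}=[L^2(\Omega)]^d$, and let $f\in H^{-1}(\Omega)$. Let $u\in V$ be the solution of the minimisation problem $$u=\operatorname*{arg\,min}_{v\in V}\left(\frac12\int_\Omega|\nabla v|^2\,dx-\ell(v)\right),$$ and let $(\tilde u,\tilde{\boldsymbol\sigma})\in V\times\mathbf{Q}$ be the solution of the variational problem $$(\tilde{\boldsymbol\sigma},\boldsymbol\tau)_{0,\Omega}+(\tilde{\boldsymbol\sigma}-2\nabla\tilde u,\ \boldsymbol\tau-2\nabla v)_{0,\Omega}=2\,\ell(v)\qquad\text{for all }(v,\boldsymbol\tau)\in V\times\mathbf{Q}.$$ Then $\tilde u=u$ and $\tilde{\boldsymbol\sigma}=\nabla u$.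
   Context: $(\cdot,\cdot)_{0,\Omega}$ denotes the $[L^2(\Omega)]^d$ inner product. For $f\in H^{-1}(\Omega)$ (the dual of $H^1_0(\Omega)$), $\ell$ is the linear form $\ell(v)=\int_\Omega f\,v\,dx$ on $H^1_0(\Omega)$, understood as the duality pairing of $f$ with $v$. *)

theory Defs
  imports "HOL-Analysis.Analysis"
begin

(* Elements of the function spaces below are represented by everywhere defined functions on the
   ambient space, of which only the values on Omega matter; equality in these spaces is
   equality almost everywhere in Omega. *)

definition L2 :: "'a::euclidean_space set \<Rightarrow> ('a \<Rightarrow> 'b::euclidean_space) set"
  where "L2 \<Omega> = {f \<in> borel_measurable (lebesgue_on \<Omega>).
                    integrable (lebesgue_on \<Omega>) (\<lambda>x. (norm (f x))\<^sup>2)}"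

definition L2_inner ::
    "'a::euclidean_space set \<Rightarrow> ('a \<Rightarrow> 'b::euclidean_space) \<Rightarrow> ('a \<Rightarrow> 'b) \<Rightarrow> real"
  where "L2_inner \<Omega> f g = (LINT x|lebesgue_on \<Omega>. f x \<bullet> g x)"

(* Class C^k on the whole space: differentiable everywhere with all partial derivatives of class
   C^(k-1). *)
fun Ck :: "nat \<Rightarrow> ('a::euclidean_space \<Rightarrow> real) \<Rightarrow> bool"
  where
    "Ck 0 f \<longleftrightarrow> continuous_on UNIV f"
  | "Ck (Suc k) f \<longleftrightarrow> (\<forall>x. f differentiable at x) \<and>
                      (\<forall>b\<in>Basis. Ck k (\<lambda>x. frechet_derivative f (at x) b))"

(* Smooth functions with compact support in Omega, extended by zero to the whole space. *)
definition test_functions :: "'a::euclidean_space set \<Rightarrow> ('a \<Rightarrow> real) set"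
  where "test_functions \<Omega> = {\<phi>. (\<forall>k. Ck k \<phi>) \<and> compact (closure {x. \<phi> x \<noteq> 0}) \<and>
                                closure {x. \<phi> x \<noteq> 0} \<subseteq> \<Omega>}"

definition has_weak_gradient ::
    "'a::euclidean_space set \<Rightarrow> ('a \<Rightarrow> real) \<Rightarrow> ('a \<Rightarrow> 'a) \<Rightarrow> bool"
  where "has_weak_gradient \<Omega> u g \<longleftrightarrow>
    (\<forall>\<phi>\<in>test_functions \<Omega>. \<forall>b\<in>Basis.
       (LINT x|lebesgue_on \<Omega>. u x * frechet_derivative \<phi> (at x) b) =
       - (LINT x|lebesgue_on \<Omega>. (g x \<bullet> b) * \<phi> x))"

definition H1 :: "'a::euclidean_space set \<Rightarrow> ('a \<Rightarrow> real) set"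
  where "H1 \<Omega> = {u \<in> L2 \<Omega>. \<exists>g\<in>L2 \<Omega>. has_weak_gradient \<Omega> u g}"

(* For open Omega the weak gradient is unique up to a null set, so this picks a representative. *)
definition wgrad :: "'a::euclidean_space set \<Rightarrow> ('a \<Rightarrow> real) \<Rightarrow> ('a \<Rightarrow> 'a)"
  where "wgrad \<Omega> u = (SOME g. g \<in> L2 \<Omega> \<and> has_weak_gradient \<Omega> u g)"

definition H1_norm :: "'a::euclidean_space set \<Rightarrow> ('a \<Rightarrow> real) \<Rightarrow> real"
  where "H1_norm \<Omega> u = sqrt (L2_inner \<Omega> u u + L2_inner \<Omega> (wgrad \<Omega> u) (wgrad \<Omega> u))"

definition H10 :: "'a::euclidean_space set \<Rightarrow> ('a \<Rightarrow> real) set"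
  where "H10 \<Omega> = {u \<in> H1 \<Omega>. \<exists>\<phi>::nat \<Rightarrow> 'a \<Rightarrow> real. (\<forall>n. \<phi> n \<in> test_functions \<Omega>) \<and>
                      (\<lambda>n. H1_norm \<Omega> (\<lambda>x. u x - \<phi> n x)) \<longlonglongrightarrow> 0}"

(* The dual of H10: bounded linear functionals. The duality pairing of f and v is f v. By
   linearity and boundedness f takes equal values on functions that agree almost everywhere
   in Omega. *)
definition Hminus1 :: "'a::euclidean_space set \<Rightarrow> (('a \<Rightarrow> real) \<Rightarrow> real) set"
  where "Hminus1 \<Omega> = {f.
    (\<forall>v\<in>H10 \<Omega>. \<forall>w\<in>H10 \<Omega>. f (\<lambda>x. v x + w x) = f v + f w) \<and>
    (\<forall>c. \<forall>v\<in>H10 \<Omega>. f (\<lambda>x. c * v x) = c * f v) \<and>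
    (\<exists>C. \<forall>v\<in>H10 \<Omega>. \<bar>f v\<bar> \<le> C * H1_norm \<Omega> v)}"

(* For a convex domain, having a polygonal or polyhedral boundary means that the closure is
   a polyhedron, i.e. a finite intersection of closed half-spaces. *)
definition bounded_convex_polyhedral_domain :: "'a::euclidean_space set \<Rightarrow> bool"
  where "bounded_convex_polyhedral_domain \<Omega> \<longleftrightarrow>
    open \<Omega> \<and> \<Omega> \<noteq> {} \<and> bounded \<Omega> \<and> convex \<Omega> \<and> polyhedron (closure \<Omega>)"

end

(* Testing with v = 0 gives sigma = grad u', and then testing with tau = 0 gives the weak equation
   (grad u', grad v) = l(v).  With w = u - u' this turns the energy gap J(u) - J(u') into
   1/2 ||grad w||^2, so minimality of u forces grad w = 0, and the Poincare inequality gives w = 0.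
   Weak gradients are only chosen representatives, so linearity of v |-> grad v rests on their
   uniqueness, that is, on the fundamental lemma of the calculus of variations. *)

theory Submission
  imports Defs "HOL-Computational_Algebra.Polynomial"
begin

subsection \<open>Smooth bump functions\<close>

text \<open>The obstacle behind uniqueness of weak gradients is to supply enough elements of
  \<open>test_functions\<close>: each must satisfy the recursive predicate \<open>Ck k\<close> for
  every k and have compact support in the domain. Products over the coordinates of exp(-1/t), set to
  0 for t \<le> 0, provide them. Rescaled, these products converge pointwise to indicators of open
  boxes, and since open boxes generate the Borel sets, this family is already rich enough for the
  fundamental lemma, without mollification. Integration by parts rests on translation invariance of
  Lebesgue measure: a directional derivative of a compactly supported function has integral zero.
  This one fact yields both that a classical gradient is a weak gradient and the Poincare inequality
  for test functions. The latter passes to \<open>H10\<close> through the approximating sequences in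
  its definition.\<close>

lemma has_derivative_imp_frechet_derivative_eq:
  "(f has_derivative f') (at x) \<Longrightarrow> frechet_derivative f (at x) = f'"
  using frechet_derivative_at by metis

lemma Ck_SucI:
  assumes "\<And>x. (f has_derivative D x) (at x)" and "\<And>b. b \<in> Basis \<Longrightarrow> Ck k (\<lambda>x. D x b)"
  shows "Ck (Suc k) f"
  using assms by (auto simp: has_derivative_imp_frechet_derivative_eq[OF assms(1)]
      intro: differentiableI)

lemma Ck_SucD:
  assumes "Ck (Suc k) f"
  shows "(f has_derivative frechet_derivative f (at x)) (at x)"
    and "b \<in> Basis \<Longrightarrow> Ck k (\<lambda>x. frechet_derivative f (at x) b)"
  using assms by (auto simp flip: frechet_derivative_works)

lemma Ck_Suc_imp_Ck: "Ck (Suc k) f \<Longrightarrow> Ck k f"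
proof (induction k arbitrary: f)
  case 0
  then show ?case
    by (auto intro!: continuous_at_imp_continuous_on differentiable_imp_continuous_within)
next
  case (Suc k)
  then show ?case
    using Ck.simps(2) by blast
qed

lemma Ck_const: "Ck k (\<lambda>x. c)"
proof (induction k arbitrary: c)
  case (Suc k)
  then show ?case
    by (intro Ck_SucI[where D = "\<lambda>_ _. 0"]) (auto intro!: derivative_eq_intros)
qed simp

lemma Ck_add: "Ck k f \<Longrightarrow> Ck k g \<Longrightarrow> Ck k (\<lambda>x. f x + g x)"
proof (induction k arbitrary: f g)
  case 0
  then show ?case by (auto intro: continuous_intros)
next
  case (Suc k)
  note D = Ck_SucD[OF Suc.prems(1)] Ck_SucD[OF Suc.prems(2)]
  show ?case
    by (rule Ck_SucI[OF has_derivative_add[OF D(1,3)]]) (intro Suc.IH D)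
qed

text \<open>The product rule leaves one factor undifferentiated in each summand, so the induction
  step also needs \<open>f\<close> and \<open>g\<close> one order lower, which
  \<open>Ck_Suc_imp_Ck\<close> supplies.\<close>

lemma Ck_mult: "Ck k f \<Longrightarrow> Ck k g \<Longrightarrow> Ck k (\<lambda>x. f x * g x)"
proof (induction k arbitrary: f g)
  case 0
  then show ?case by (auto intro: continuous_intros)
next
  case (Suc k)
  note D = Ck_SucD[OF Suc.prems(1)] Ck_SucD[OF Suc.prems(2)]
  show ?case
    by (rule Ck_SucI[OF has_derivative_mult[OF D(1,3)]])
      (intro Ck_add Suc.IH D Suc.prems[THEN Ck_Suc_imp_Ck])
qed

lemma Ck_diff: "Ck k f \<Longrightarrow> Ck k g \<Longrightarrow> Ck k (\<lambda>x. f x - g x)"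
  using Ck_add[of k f "\<lambda>x. - 1 * g x"] Ck_mult[OF Ck_const, of k g "- 1"] by simp

lemma Ck_prod: "(\<And>i. i \<in> I \<Longrightarrow> Ck k (f i)) \<Longrightarrow> Ck k (\<lambda>x. \<Prod>i\<in>I. f i x)"
proof (induction I rule: infinite_finite_induct)
  case (insert i I)
  then show ?case by (simp add: Ck_mult)
qed (simp_all add: Ck_const)

text \<open>The polynomial factor makes this family closed under differentiation.\<close>

definition flat :: "real poly \<Rightarrow> real \<Rightarrow> real"
  where "flat p t = (if t > 0 then poly p (inverse t) * exp (- inverse t) else 0)"

lemma flat_nonpos: "t \<le> 0 \<Longrightarrow> flat p t = 0"
  by (simp add: flat_def)

lemma poly_times_exp_minus_tendsto_0:
  "((\<lambda>s::real. poly p s * exp (- s)) \<longlongrightarrow> 0) at_top"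
proof -
  have "((\<lambda>s::real. \<Sum>i\<le>degree p. coeff p i * (s ^ i / exp s)) \<longlongrightarrow>
      (\<Sum>i\<le>degree p. coeff p i * 0)) at_top"
    by (intro tendsto_intros tendsto_power_div_exp_0)
  moreover have "(\<Sum>i\<le>degree p. coeff p i * (s ^ i / exp s)) = poly p s * exp (- s)" for s
    by (simp add: poly_altdef sum_distrib_right exp_minus divide_inverse mult.assoc)
  ultimately show ?thesis by simp
qed

text \<open>From the right the substitution s = 1/t reduces the claim to exponential decay beating a
  polynomial; from the left the function is identically 0.\<close>

lemma flat_tendsto_0: "(flat p \<longlongrightarrow> 0) (at 0)"
proof (rule filterlim_split_at)
  have "eventually (\<lambda>t. t < 0) (at_left (0::real))"
    by (simp add: eventually_at_filter)
  then have "eventually (\<lambda>t. 0 = flat p t) (at_left 0)"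
    by eventually_elim (simp add: flat_def)
  then show "(flat p \<longlongrightarrow> 0) (at_left 0)"
    by (rule Lim_transform_eventually[OF tendsto_const])
  have "eventually (\<lambda>t. poly p (inverse t) * exp (- inverse t) = flat p t) (at_right 0)"
    using eventually_at_right_less[of "0::real"] by eventually_elim (simp add: flat_def)
  then show "(flat p \<longlongrightarrow> 0) (at_right 0)"
    by (rule Lim_transform_eventually[OF filterlim_compose[OF
      poly_times_exp_minus_tendsto_0 filterlim_inverse_at_top_right]])
qed

text \<open>With s = 1/t, so that ds/dt = -s^2, the derivative of p(s) exp(-s) in t is s^2 (p(s) -
  p'(s)) exp(-s). The polynomial \<open>[:0, 0, 1:]\<close> is s^2.\<close>

lemma flat_has_real_derivative:
  "(flat p has_real_derivative flat ([:0, 0, 1:] * (p - pderiv p)) t) (at t)"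
proof (cases t "0::real" rule: linorder_cases)
  case less
  have "((\<lambda>t. 0) has_real_derivative 0) (at t)" by simp
  then have "(flat p has_real_derivative 0) (at t)"
    by (rule has_field_derivative_transform_within_open[of _ _ _ "{..<0}"])
      (use less in \<open>auto simp: flat_def\<close>)
  then show ?thesis
    using less by (simp add: flat_def)
next
  case equal
  \<comment> \<open>Dividing by h multiplies the polynomial by s = 1/h, so the difference quotient
    at 0 is again a member of the family and tends to 0.\<close>
  have "((\<lambda>h. (flat p (0 + h) - flat p 0) / h) \<longlongrightarrow> 0) (at 0)"
  proof (rule Lim_transform_eventually[OF flat_tendsto_0[of "[:0, 1:] * p"]])
    show "eventually (\<lambda>h. flat ([:0, 1:] * p) h = (flat p (0 + h) - flat p 0) / h) (at 0)"
      by (auto simp: flat_def field_simps intro: always_eventually)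
  qed
  then have "(flat p has_real_derivative 0) (at 0)"
    by (simp add: DERIV_def)
  then show ?thesis
    using equal by (simp add: flat_def)
next
  case greater
  have "((\<lambda>t. poly p (inverse t) * exp (- inverse t)) has_real_derivative
      flat ([:0, 0, 1:] * (p - pderiv p)) t) (at t)"
    by (rule DERIV_cong[OF DERIV_mult[OF DERIV_chain2[OF poly_DERIV] DERIV_chain2[OF DERIV_exp]]])
      (use greater in \<open>auto intro!: derivative_eq_intros DERIV_inverse'
        simp: flat_def algebra_simps power2_eq_square\<close>)
  then show ?thesis
    by (rule has_field_derivative_transform_within_open[of _ _ _ "{0<..}"])
      (use greater in \<open>auto simp: flat_def\<close>)
qed

text \<open>The induction must range over all \<open>p\<close>, because each differentiation
  replaces \<open>p\<close> by another polynomial; the inner derivative contributes only a constant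
  factor.\<close>

lemma Ck_flat_affine:
  fixes b :: "'a::euclidean_space"
  shows "Ck k (\<lambda>x. flat p (c * (x \<bullet> b) + d))"
proof (induction k arbitrary: p)
  case 0
  have "isCont (flat p) t" for t
    using flat_has_real_derivative by (rule DERIV_isCont)
  then have "continuous_on UNIV (flat p)"
    by (simp add: continuous_at_imp_continuous_on)
  then show ?case
    by (auto intro!: continuous_intros continuous_on_compose2[of UNIV "flat p"])
next
  case (Suc k)
  let ?q = "[:0, 0, 1:] * (p - pderiv p)"
  have "((\<lambda>x. flat p (c * (x \<bullet> b) + d)) has_derivative
      (\<lambda>h. flat ?q (c * (x \<bullet> b) + d) * (c * (h \<bullet> b)))) (at x)" for x
    by (rule has_derivative_compose[of "\<lambda>x. c * (x \<bullet> b) + d" _ _ _ "flat p",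
          OF _ flat_has_real_derivative[unfolded has_field_derivative_def]])
      (auto intro!: derivative_eq_intros)
  then show ?case
    by (rule Ck_SucI) (intro Ck_mult Suc Ck_const)
qed

text \<open>A smooth approximation of the indicator of the open box: inside, the scale n + 1 drives
  every argument to infinity, where exp(-1/t) tends to 1, while outside some factor is 0 for every
  n. The arguments are spelled out in the shape c (x \<bullet> i) + d so that
  \<open>Ck_flat_affine\<close> applies literally.\<close>

definition box_bump :: "'a::euclidean_space \<Rightarrow> 'a \<Rightarrow> nat \<Rightarrow> 'a \<Rightarrow> real"
  where "box_bump a b n x = (\<Prod>i\<in>Basis.
    flat 1 (real (Suc n) * (x \<bullet> i) + - real (Suc n) * (a \<bullet> i)) *
    flat 1 (- real (Suc n) * (x \<bullet> i) + real (Suc n) * (b \<bullet> i)))"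

lemma Ck_box_bump: "Ck k (box_bump a b n)"
  unfolding box_bump_def by (intro Ck_prod Ck_mult Ck_flat_affine)

lemma flat_1_bounds: "0 \<le> flat 1 t" "flat 1 t \<le> 1"
  by (auto simp: flat_def)

lemma box_bump_bounds: "0 \<le> box_bump a b n x" "box_bump a b n x \<le> 1"
  unfolding box_bump_def
  by (auto intro!: prod_nonneg prod_le_1 mult_nonneg_nonneg mult_le_one flat_1_bounds)

lemma box_bump_outside:
  assumes "x \<notin> box a b"
  shows "box_bump a b n x = 0"
proof -
  obtain i where i: "i \<in> Basis" "x \<bullet> i \<le> a \<bullet> i \<or> b \<bullet> i \<le> x \<bullet> i"
    using assms by (auto simp: mem_box not_less)
  have "real (Suc n) * (x \<bullet> i) + - real (Suc n) * (a \<bullet> i) \<le> 0 \<or>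
      - real (Suc n) * (x \<bullet> i) + real (Suc n) * (b \<bullet> i) \<le> 0"
    using i(2) mult_left_mono[of "x \<bullet> i" "a \<bullet> i" "real (Suc n)"]
      mult_left_mono[of "b \<bullet> i" "x \<bullet> i" "real (Suc n)"] by (auto simp del: of_nat_Suc)
  then have "flat 1 (real (Suc n) * (x \<bullet> i) + - real (Suc n) * (a \<bullet> i)) *
      flat 1 (- real (Suc n) * (x \<bullet> i) + real (Suc n) * (b \<bullet> i)) = 0"
    by (elim disjE) (simp_all only: flat_nonpos mult_zero_left mult_zero_right)
  then show ?thesis
    unfolding box_bump_def using i(1) by (intro prod_zero finite_Basis bexI[of _ i])
qed

lemma flat_1_scaled_tendsto_1:
  assumes "t > 0"
  shows "(\<lambda>n. flat 1 (real (Suc n) * t)) \<longlonglongrightarrow> 1"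
proof -
  have "(\<lambda>n. exp (- (inverse (real (Suc n)) * inverse t))) \<longlonglongrightarrow> exp (- (0 * inverse t))"
    by (intro tendsto_intros LIMSEQ_inverse_real_of_nat)
  then show ?thesis
    using assms by (simp add: flat_def inverse_mult_distrib)
qed

lemma box_bump_tendsto: "(\<lambda>n. box_bump a b n x) \<longlonglongrightarrow> indicator (box a b) x"
proof (cases "x \<in> box a b")
  case True
  have "(\<lambda>n. \<Prod>i\<in>Basis. flat 1 (real (Suc n) * (x \<bullet> i - a \<bullet> i)) *
      flat 1 (real (Suc n) * (b \<bullet> i - x \<bullet> i))) \<longlonglongrightarrow> (\<Prod>i\<in>(Basis :: 'a set). 1 * 1)"
    using True by (intro tendsto_prod tendsto_mult flat_1_scaled_tendsto_1) (auto simp: mem_box)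
  then show ?thesis
    using True by (simp add: box_bump_def algebra_simps)
qed (simp add: box_bump_outside)

lemma box_bump_test_function:
  assumes "cbox a b \<subseteq> \<Omega>"
  shows "box_bump a b n \<in> test_functions \<Omega>"
proof -
  have "{x. box_bump a b n x \<noteq> 0} \<subseteq> cbox a b"
    using box_bump_outside box_subset_cbox by blast
  then have "closure {x. box_bump a b n x \<noteq> 0} \<subseteq> cbox a b"
    by (intro closure_minimal) auto
  moreover then have "compact (closure {x. box_bump a b n x \<noteq> 0})"
    by (meson bounded_cbox bounded_subset closed_closure compact_eq_bounded_closed)
  ultimately show ?thesis
    using assms Ck_box_bump by (auto simp: test_functions_def)
qed

subsection \<open>Integrals of compactly supported functions\<close>

lemma integrable_compact_support:
  fixes f :: "'a::euclidean_space \<Rightarrow> 'b::{banach, second_countable_topology}"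
  assumes "continuous_on UNIV f" "compact K" "\<And>x. x \<notin> K \<Longrightarrow> f x = 0"
  shows "integrable lborel f"
proof -
  have "(\<lambda>x. indicator K x *\<^sub>R f x) = f"
    using assms(3) by (auto simp: indicator_def fun_eq_iff)
  then show ?thesis
    using borel_integrable_compact[OF assms(2) continuous_on_subset[OF assms(1) subset_UNIV]]
    by simp
qed

lemma has_derivative_zero_outside:
  fixes f :: "'a::real_normed_vector \<Rightarrow> 'b::real_normed_vector"
  assumes "(f has_derivative D) (at x)" "closed K" "\<And>x. x \<notin> K \<Longrightarrow> f x = 0" "x \<notin> K"
  shows "D h = 0"
proof -
  have "((\<lambda>x. 0) has_derivative D) (at x)"
    using assms by (intro has_derivative_transform_within_open[OF assms(1), of "- K"]) auto
  then show ?thesis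
    using has_derivative_unique[OF _ has_derivative_const] by (metis (no_types))
qed

text \<open>The integral of a difference quotient vanishes by translation invariance.\<close>

lemma integral_directional_derivative_eq_0:
  fixes f :: "'a::euclidean_space \<Rightarrow> real"
  assumes D: "\<And>x. (f has_derivative D x) (at x)"
    and cont: "continuous_on UNIV (\<lambda>x. D x b)"
    and K: "compact K" "\<And>x. x \<notin> K \<Longrightarrow> f x = 0"
  shows "(LINT x|lborel. D x b) = 0"
proof -
  let ?t = "\<lambda>n. inverse (real (Suc n))"
  define q where "q n x = (f (x + ?t n *\<^sub>R b) - f x) / ?t n" for n x
  have cont_f: "continuous_on UNIV f"
    using D by (auto intro!: continuous_at_imp_continuous_on dest: has_derivative_continuous)
  have int_f: "integrable lborel f"
    by (rule integrable_compact_support[OF cont_f K])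
  have distr: "lborel = distr lborel borel (\<lambda>x. x + h)" for h :: 'a
    by (subst lborel_distr_plus[of h, symmetric]) (auto intro!: arg_cong[of _ _ "distr lborel borel"])
  have int_shift: "integrable lborel (\<lambda>x. f (x + h))" for h
    using int_f by (subst (asm) distr[of h], subst (asm) integrable_distr_eq)
      (use cont_f in \<open>auto intro: borel_measurable_continuous_onI\<close>)
  have shift: "(LINT x|lborel. f (x + h)) = (LINT x|lborel. f x)" for h
    using cont_f by (subst (2) distr[of h], subst integral_distr)
      (auto intro: borel_measurable_continuous_onI)
  have q_int: "(LINT x|lborel. q n x) = 0" for n
    unfolding q_def using int_f int_shift[of "?t n *\<^sub>R b"] shift[of "?t n *\<^sub>R b"] by simp
  have deriv_line: "((\<lambda>s. f (x + s *\<^sub>R b)) has_real_derivative D (x + s *\<^sub>R b) b) (at s)" for x s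
  proof -
    have "((\<lambda>s. f (x + s *\<^sub>R b)) has_derivative (\<lambda>h. D (x + s *\<^sub>R b) (h *\<^sub>R b))) (at s)"
      by (rule has_derivative_compose[of "\<lambda>s. x + s *\<^sub>R b" _ _ _ f, OF _ D])
        (auto intro!: derivative_eq_intros)
    moreover have "D (x + s *\<^sub>R b) (h *\<^sub>R b) = h * D (x + s *\<^sub>R b) b" for h
      using has_derivative_linear[OF D] by (simp add: linear_scale)
    ultimately show ?thesis
      by (intro has_derivative_imp_has_field_derivative) auto
  qed
  have q_lim: "(\<lambda>n. q n x) \<longlonglongrightarrow> D x b" for x
  proof -
    have "((\<lambda>h. (f (x + h *\<^sub>R b) - f x) / h) \<longlongrightarrow> D x b) (at 0)"
      using deriv_line[of x 0] by (simp add: DERIV_def)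
    moreover have "filterlim ?t (at 0) sequentially"
      using LIMSEQ_inverse_real_of_nat by (auto simp: filterlim_at)
    ultimately show ?thesis
      unfolding q_def by (rule filterlim_compose)
  qed
  have D0: "D x b = 0" if "x \<notin> K" for x
    using has_derivative_zero_outside[OF D _ K(2) that] K(1) by (simp add: compact_imp_closed)
  have "bounded ((\<lambda>x. D x b) ` K)"
    using K(1) cont by (meson compact_continuous_image compact_imp_bounded continuous_on_subset subset_UNIV)
  then obtain M where M: "M > 0" "\<And>x. x \<in> K \<Longrightarrow> \<bar>D x b\<bar> \<le> M"
    by (auto simp: bounded_pos)
  then have M': "\<bar>D x b\<bar> \<le> M" for x
    using D0[of x] by (cases "x \<in> K") auto
  obtain R where R: "\<And>x. x \<in> K \<Longrightarrow> norm x \<le> R"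
    using compact_imp_bounded[OF K(1)] by (auto simp: bounded_iff)
  \<comment> \<open>The steps \<open>?t n\<close> are at most 1, so a point outside this ball stays
    outside \<open>K\<close> even after the shift by \<open>?t n *\<^sub>R b\<close>. One ball
    therefore carries the supports of all difference quotients.\<close>
  let ?B = "cball 0 (R + norm b) :: 'a set"
  have q_bound: "norm (q n x) \<le> indicator ?B x *\<^sub>R M" for n x
  proof (cases "x \<in> ?B")
    case True
    \<comment> \<open>By the mean value theorem a difference quotient is a value of the derivative,
      so the bound \<open>M\<close> on the derivative dominates all of them.\<close>
    obtain z where "f (x + ?t n *\<^sub>R b) - f (x + 0 *\<^sub>R b) = (?t n - 0) * D (x + z *\<^sub>R b) b"
      using MVT2[OF _ deriv_line, of 0 "?t n" x] by auto
    then have "q n x = D (x + z *\<^sub>R b) b"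
      by (simp add: q_def field_simps del: of_nat_Suc)
    then show ?thesis
      using True M' by simp
  next
    case False
    have "?t n \<le> 1"
      by (simp add: field_simps)
    then have "norm (?t n *\<^sub>R b) \<le> norm b"
      by (simp add: mult_left_le_one_le del: of_nat_Suc)
    then have "norm (x + ?t n *\<^sub>R b) > R"
      using False norm_diff_ineq[of x "?t n *\<^sub>R b"] by (simp del: of_nat_Suc norm_scaleR)
    moreover have "norm x > R"
      using False norm_ge_zero[of b] by (simp del: norm_ge_zero)
    ultimately have "x \<notin> K" "x + ?t n *\<^sub>R b \<notin> K"
      using R by (force simp del: of_nat_Suc)+
    then show ?thesis
      using False K(2) by (simp add: q_def del: of_nat_Suc)
  qed
  have "(\<lambda>n. LINT x|lborel. q n x) \<longlonglongrightarrow> (LINT x|lborel. D x b)"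
  proof (rule integral_dominated_convergence)
    show "(\<lambda>x. D x b) \<in> borel_measurable lborel"
      using borel_measurable_continuous_onI[OF cont] by simp
    show "q n \<in> borel_measurable lborel" for n
      unfolding q_def using int_f int_shift[of "?t n *\<^sub>R b"] by measurable
    show "integrable lborel (\<lambda>x. indicator ?B x *\<^sub>R M)"
      by (rule borel_integrable_compact) auto
  qed (use q_lim q_bound in auto)
  then show ?thesis
    using q_int by (simp add: LIMSEQ_const_iff)
qed

lemma integrable_lebesgue_onI:
  fixes f :: "'a::euclidean_space \<Rightarrow> 'b::euclidean_space"
  assumes "\<Omega> \<in> sets lebesgue" "integrable lborel f"
  shows "integrable (lebesgue_on \<Omega>) f"
proof -
  have "integrable lebesgue f"
    using assms(2) by (subst integrable_completion) auto
  then show ?thesis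
    using integrable_mult_indicator[OF assms(1)] assms(1) by (simp add: integrable_restrict_space)
qed

text \<open>The Sobolev notions integrate over \<open>lebesgue_on\<close>, while the translation
  argument runs in \<open>lborel\<close>; for functions vanishing outside the domain the two
  integrals coincide.\<close>

lemma integral_lebesgue_on_eq_lborel:
  fixes f :: "'a::euclidean_space \<Rightarrow> real"
  assumes "\<Omega> \<in> sets lebesgue" "f \<in> borel_measurable borel" "\<And>x. x \<notin> \<Omega> \<Longrightarrow> f x = 0"
  shows "(LINT x|lebesgue_on \<Omega>. f x) = (LINT x|lborel. f x)"
proof -
  have "(LINT x|lebesgue_on \<Omega>. f x) = (LINT x|lebesgue. indicator \<Omega> x *\<^sub>R f x)"
    using assms(1) by (simp add: integral_restrict_space)
  also have "(\<lambda>x. indicator \<Omega> x *\<^sub>R f x) = f"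
    using assms(3) by (auto simp: indicator_def fun_eq_iff)
  finally show ?thesis
    using assms(2) by (simp add: integral_completion)
qed

subsection \<open>Test functions\<close>

lemma test_function_support:
  assumes "\<phi> \<in> test_functions \<Omega>"
  shows "\<exists>K. compact K \<and> K \<subseteq> \<Omega> \<and> (\<forall>x. x \<notin> K \<longrightarrow> \<phi> x = 0)"
  using assms closure_subset[of "{x. \<phi> x \<noteq> 0}"]
  by (intro exI[of _ "closure {x. \<phi> x \<noteq> 0}"]) (auto simp: test_functions_def)

lemma test_functionD:
  assumes "\<phi> \<in> test_functions \<Omega>"
  shows "continuous_on UNIV \<phi>"
    and "(\<phi> has_derivative frechet_derivative \<phi> (at x)) (at x)"
    and "b \<in> Basis \<Longrightarrow> continuous_on UNIV (\<lambda>x. frechet_derivative \<phi> (at x) b)"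
proof -
  have Ck: "Ck k \<phi>" for k
    using assms by (auto simp: test_functions_def)
  show "continuous_on UNIV \<phi>"
    using Ck[of 0] by simp
  show "(\<phi> has_derivative frechet_derivative \<phi> (at x)) (at x)"
    using Ck_SucD(1)[OF Ck] .
  show "b \<in> Basis \<Longrightarrow> continuous_on UNIV (\<lambda>x. frechet_derivative \<phi> (at x) b)"
    using Ck_SucD(2)[OF Ck, of b 0] by simp
qed

lemma test_function_diff:
  assumes "\<phi> \<in> test_functions \<Omega>" "\<psi> \<in> test_functions \<Omega>"
  shows "(\<lambda>x. \<phi> x - \<psi> x) \<in> test_functions \<Omega>"
proof -
  let ?S = "\<lambda>f :: 'a \<Rightarrow> real. closure {x. f x \<noteq> 0}"
  have "?S (\<lambda>x. \<phi> x - \<psi> x) \<subseteq> closure ({x. \<phi> x \<noteq> 0} \<union> {x. \<psi> x \<noteq> 0})"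
    by (rule closure_mono) auto
  then have sub: "?S (\<lambda>x. \<phi> x - \<psi> x) \<subseteq> ?S \<phi> \<union> ?S \<psi>"
    by simp
  moreover have "compact (?S \<phi> \<union> ?S \<psi>)"
    using assms by (auto simp: test_functions_def)
  ultimately have "compact (?S (\<lambda>x. \<phi> x - \<psi> x))"
    by (meson bounded_subset closed_closure compact_eq_bounded_closed)
  then show ?thesis
    using sub assms by (auto simp: test_functions_def intro: Ck_diff)
qed

definition gradient :: "('a::euclidean_space \<Rightarrow> real) \<Rightarrow> 'a \<Rightarrow> 'a"
  where "gradient f x = (\<Sum>b\<in>Basis. frechet_derivative f (at x) b *\<^sub>R b)"

lemma gradient_inner_Basis:
  "b \<in> Basis \<Longrightarrow> gradient f x \<bullet> b = frechet_derivative f (at x) b"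
  by (simp add: gradient_def)

lemma continuous_compact_support_in_L2:
  fixes f :: "'a::euclidean_space \<Rightarrow> 'b::euclidean_space"
  assumes \<Omega>: "\<Omega> \<in> sets lebesgue"
    and f: "continuous_on UNIV f" "compact K" "\<And>x. x \<notin> K \<Longrightarrow> f x = 0"
  shows "f \<in> L2 \<Omega>"
proof -
  have "integrable lborel (\<lambda>x. (norm (f x))\<^sup>2)"
    using f by (intro integrable_compact_support continuous_intros) auto
  then have "integrable (lebesgue_on \<Omega>) (\<lambda>x. (norm (f x))\<^sup>2)"
    by (rule integrable_lebesgue_onI[OF \<Omega>])
  moreover have "f \<in> borel_measurable (lebesgue_on \<Omega>)"
    using \<Omega> f(1) continuous_on_subset
    by (blast intro: continuous_imp_measurable_on_sets_lebesgue)
  ultimately show ?thesis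
    by (simp add: L2_def)
qed

lemma test_function_in_L2:
  assumes "\<Omega> \<in> sets lebesgue" "\<phi> \<in> test_functions \<Omega>"
  shows "\<phi> \<in> L2 \<Omega>"
proof -
  obtain K where K: "compact K" "K \<subseteq> \<Omega>" "\<And>x. x \<notin> K \<Longrightarrow> \<phi> x = 0"
    using test_function_support[OF assms(2)] by auto
  show ?thesis
    by (rule continuous_compact_support_in_L2[OF assms(1) test_functionD(1)[OF assms(2)] K(1,3)])
qed

lemma gradient_test_function_in_L2:
  assumes "\<Omega> \<in> sets lebesgue" "\<phi> \<in> test_functions \<Omega>"
  shows "gradient \<phi> \<in> L2 \<Omega>"
proof -
  obtain K where K: "compact K" "K \<subseteq> \<Omega>" "\<And>x. x \<notin> K \<Longrightarrow> \<phi> x = 0"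
    using test_function_support[OF assms(2)] by auto
  have "continuous_on UNIV (gradient \<phi>)"
    unfolding gradient_def by (intro continuous_intros test_functionD(3)[OF assms(2)])
  moreover have "gradient \<phi> x = 0" if "x \<notin> K" for x
    using has_derivative_zero_outside[OF test_functionD(2)[OF assms(2)] _ K(3) that] K(1)
    by (simp add: gradient_def compact_imp_closed)
  ultimately show ?thesis
    by (rule continuous_compact_support_in_L2[OF assms(1) _ K(1)])
qed

text \<open>This is integration by parts: the product of \<phi> and the test function \<eta> has
  compact support, so the integral of its derivative, expanded by the product rule, is zero.\<close>

lemma has_weak_gradient_test_function:
  assumes \<Omega>: "\<Omega> \<in> sets lebesgue" and \<phi>: "\<phi> \<in> test_functions \<Omega>"
  shows "has_weak_gradient \<Omega> \<phi> (gradient \<phi>)"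
  unfolding has_weak_gradient_def
proof (intro ballI)
  fix \<eta> and b :: 'a
  assume \<eta>: "\<eta> \<in> test_functions \<Omega>" and b: "b \<in> Basis"
  note D = test_functionD[OF \<phi>] test_functionD[OF \<eta>]
  obtain K where K: "compact K" "K \<subseteq> \<Omega>" "\<And>x. x \<notin> K \<Longrightarrow> \<phi> x = 0"
    using test_function_support[OF \<phi>] by auto
  obtain L where L: "compact L" "L \<subseteq> \<Omega>" "\<And>x. x \<notin> L \<Longrightarrow> \<eta> x = 0"
    using test_function_support[OF \<eta>] by auto
  let ?f = "\<lambda>x. \<phi> x * frechet_derivative \<eta> (at x) b"
  let ?g = "\<lambda>x. frechet_derivative \<phi> (at x) b * \<eta> x"
  have cont: "continuous_on UNIV ?f" "continuous_on UNIV ?g"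
    by (intro continuous_intros D b)+
  have "(LINT x|lborel. ?f x + ?g x) = 0"
    by (rule integral_directional_derivative_eq_0[OF has_derivative_mult[OF D(2,5)] _ K(1)])
      (use K(3) cont in \<open>auto intro: continuous_on_add\<close>)
  moreover have "integrable lborel ?f"
    by (rule integrable_compact_support[OF cont(1) K(1)]) (simp add: K(3))
  moreover have "integrable lborel ?g"
    by (rule integrable_compact_support[OF cont(2) L(1)]) (simp add: L(3))
  moreover have "(LINT x|lebesgue_on \<Omega>. ?f x) = (LINT x|lborel. ?f x)"
    by (rule integral_lebesgue_on_eq_lborel[OF \<Omega> borel_measurable_continuous_onI[OF cont(1)]])
      (use K in auto)
  moreover have "(LINT x|lebesgue_on \<Omega>. ?g x) = (LINT x|lborel. ?g x)"
    by (rule integral_lebesgue_on_eq_lborel[OF \<Omega> borel_measurable_continuous_onI[OF cont(2)]])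
      (use L in auto)
  ultimately show "(LINT x|lebesgue_on \<Omega>. ?f x) =
      - (LINT x|lebesgue_on \<Omega>. (gradient \<phi> x \<bullet> b) * \<eta> x)"
    using b by (simp add: gradient_inner_Basis)
qed

text \<open>Integrate \<open>\<phi>\<^sup>2 = \<partial>\<^sub>b (x\<^sub>b \<phi>\<^sup>2) - 2 x\<^sub>b \<phi> \<partial>\<^sub>b \<phi>\<close> and absorb half of \<open>\<phi>\<^sup>2\<close> by Young's
  inequality.\<close>

lemma Poincare_test_function:
  fixes \<Omega> :: "'a::euclidean_space set"
  assumes \<Omega>: "\<Omega> \<in> sets lebesgue" and R: "\<And>x. x \<in> \<Omega> \<Longrightarrow> norm x \<le> R"
    and \<phi>: "\<phi> \<in> test_functions \<Omega>"
  shows "L2_inner \<Omega> \<phi> \<phi> \<le> 4 * R\<^sup>2 * L2_inner \<Omega> (gradient \<phi>) (gradient \<phi>)"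
proof -
  obtain b :: 'a where b: "b \<in> Basis"
    using SOME_Basis by blast
  note D = test_functionD[OF \<phi>]
  obtain K where K: "compact K" "K \<subseteq> \<Omega>" "\<And>x. x \<notin> K \<Longrightarrow> \<phi> x = 0"
    using test_function_support[OF \<phi>] by auto
  then have \<phi>_outside: "\<phi> x = 0" if "x \<notin> \<Omega>" for x
    using that by blast
  let ?d = "\<lambda>x. frechet_derivative \<phi> (at x) b"
  let ?f = "\<lambda>x. \<phi> x * \<phi> x" and ?g = "\<lambda>x. 2 * (x \<bullet> b) * \<phi> x * ?d x"
  have cont: "continuous_on UNIV ?f" "continuous_on UNIV ?g"
    by (intro continuous_intros D b)+
  have "((\<lambda>x. (x \<bullet> b) * (\<phi> x * \<phi> x)) has_derivative
      (\<lambda>h. (x \<bullet> b) * (\<phi> x * frechet_derivative \<phi> (at x) h + frechet_derivative \<phi> (at x) h * \<phi> x) +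
        (h \<bullet> b) * (\<phi> x * \<phi> x))) (at x)" for x
    by (intro has_derivative_mult D has_derivative_inner_left has_derivative_ident)
  then have "(LINT x|lborel. (x \<bullet> b) * (\<phi> x * ?d x + ?d x * \<phi> x) + (b \<bullet> b) * ?f x) = 0"
    by (rule integral_directional_derivative_eq_0[OF _ _ K(1)])
      (use K(3) in \<open>auto intro!: continuous_intros D b\<close>)
  then have "(LINT x|lborel. ?f x + ?g x) = 0"
    using b by (simp add: algebra_simps)
  moreover have "(LINT x|lebesgue_on \<Omega>. ?f x + ?g x) = (LINT x|lborel. ?f x + ?g x)"
    by (rule integral_lebesgue_on_eq_lborel[OF \<Omega>
        borel_measurable_continuous_onI[OF continuous_on_add[OF cont]]]) (simp add: \<phi>_outside)
  ultimately have zero: "(LINT x|lebesgue_on \<Omega>. ?f x + ?g x) = 0"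
    by simp
  have int_f: "integrable (lebesgue_on \<Omega>) ?f"
    using test_function_in_L2[OF \<Omega> \<phi>] by (simp add: L2_def power2_eq_square)
  have int_grad: "integrable (lebesgue_on \<Omega>) (\<lambda>x. gradient \<phi> x \<bullet> gradient \<phi> x)"
    using gradient_test_function_in_L2[OF \<Omega> \<phi>] by (simp add: L2_def power2_norm_eq_inner)
  have int_g: "integrable (lebesgue_on \<Omega>) ?g"
    by (rule integrable_lebesgue_onI[OF \<Omega> integrable_compact_support[OF cont(2) K(1)]])
      (simp add: K(3))
  \<comment> \<open>The right side minus the left side is at least (\<phi> + 2 (x \<bullet> b) d)^2,
    where d is the partial derivative of \<phi> along \<open>b\<close>. The multiple of
    \<open>?f x + ?g x\<close> costs nothing, since its integral is 0; the factor 4 is that of the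
    completed square.\<close>
  have young: "?f x \<le> 4 * R\<^sup>2 * (gradient \<phi> x \<bullet> gradient \<phi> x) + 2 * (?f x + ?g x)" if "x \<in> \<Omega>" for x
  proof -
    have "\<bar>x \<bullet> b\<bar> \<le> R"
      using Basis_le_norm[OF b, of x] R[OF that] by simp
    then have "(x \<bullet> b)\<^sup>2 \<le> R\<^sup>2"
      by (metis abs_ge_zero power2_abs power_mono)
    moreover have "(?d x)\<^sup>2 \<le> gradient \<phi> x \<bullet> gradient \<phi> x"
      using Basis_le_norm[OF b, of "gradient \<phi> x"] b
      by (metis abs_ge_zero gradient_inner_Basis power2_abs power2_norm_eq_inner power_mono)
    ultimately have "(x \<bullet> b)\<^sup>2 * (?d x)\<^sup>2 \<le> R\<^sup>2 * (gradient \<phi> x \<bullet> gradient \<phi> x)"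
      by (intro mult_mono) auto
    moreover have "0 \<le> (\<phi> x + 2 * (x \<bullet> b) * ?d x)\<^sup>2"
      by simp
    ultimately show ?thesis
      by (simp add: power2_eq_square algebra_simps)
  qed
  have "(LINT x|lebesgue_on \<Omega>. ?f x) \<le>
      (LINT x|lebesgue_on \<Omega>. 4 * R\<^sup>2 * (gradient \<phi> x \<bullet> gradient \<phi> x) + 2 * (?f x + ?g x))"
    by (intro integral_mono int_f Bochner_Integration.integrable_add integrable_mult_right
        int_grad int_g young) simp
  also have "\<dots> = 4 * R\<^sup>2 * (LINT x|lebesgue_on \<Omega>. gradient \<phi> x \<bullet> gradient \<phi> x) +
      2 * (LINT x|lebesgue_on \<Omega>. ?f x + ?g x)"
    using int_f int_g int_grad
    by (subst Bochner_Integration.integral_add) (auto simp del: distrib_left_numeral)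
  finally show ?thesis
    using zero by (simp add: L2_inner_def)
qed

subsection \<open>The fundamental lemma of the calculus of variations\<close>

text \<open>Open boxes form an intersection-stable generator of the Borel sets, so by Dynkin's
  argument the integral of the truncated function vanishes over every Borel set, which forces the
  function to vanish almost everywhere.\<close>

lemma AE_zero_on_box_if_box_integrals_zero:
  fixes g :: "'a::euclidean_space \<Rightarrow> real"
  assumes g: "integrable lborel g"
    and zero: "\<And>c d. box c d \<subseteq> box a b \<Longrightarrow> (LINT x:box c d|lborel. g x) = 0"
  shows "AE x in lborel. x \<in> box a b \<longrightarrow> g x = 0"
proof -
  \<comment> \<open>Truncation extends the hypothesis from subboxes of \<open>box a b\<close> to
    arbitrary boxes, since the intersection of two boxes is a box.\<close>
  let ?f = "\<lambda>x. indicator (box a b) x *\<^sub>R g x"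
  have f: "integrable lborel ?f"
    using g by (intro integrable_mult_indicator) auto
  have f_set: "set_integrable lborel A ?f" if "A \<in> sets borel" for A
    unfolding set_integrable_def using that f by (intro integrable_mult_indicator[of A lborel ?f]) simp_all
  have box0: "(LINT x:box c d|lborel. ?f x) = 0" for c d
  proof -
    have "(LINT x:box c d|lborel. ?f x) = (LINT x:box c d \<inter> box a b|lborel. g x)"
      unfolding set_lebesgue_integral_def by (simp add: indicator_inter_arith mult.assoc)
    also have "\<dots> = 0"
      using zero[OF eq_refl[OF box_Int_box[symmetric], THEN order_trans, OF Int_lower2]]
      by (simp only: box_Int_box)
    finally show ?thesis .
  qed
  let ?G = "range (\<lambda>(c, d). box c d :: 'a set)"
  have "(LINT x:A|lborel. ?f x) = 0" if "A \<in> sets borel" for A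
  proof -
    have sig: "sets borel = sigma_sets UNIV ?G"
      by (subst borel_eq_box) simp
    have "Int_stable ?G"
      by (auto simp: Int_stable_def box_Int_box)
    moreover have "?G \<subseteq> Pow UNIV" by simp
    moreover have "A \<in> sigma_sets UNIV ?G"
      using that sig by simp
    ultimately show ?thesis
    proof (induction rule: sigma_sets_induct_disjoint)
      case (basic A)
      then show ?case using box0 by auto
    next
      case empty
      then show ?case by (simp add: set_lebesgue_integral_def)
    next
      case (compl A)
      then have A: "A \<in> sets borel" using sig by simp
      \<comment> \<open>The whole space is not one of the generating boxes, but by truncation its
        integral is the one over \<open>box a b\<close>. Complements follow by subtraction.\<close>
      have "(LINT x|lborel. ?f x) = 0"
        using zero[of a b] by (simp add: set_lebesgue_integral_def)
      moreover have "(LINT x:UNIV - A|lborel. ?f x) = (LINT x|lborel. ?f x - indicator A x *\<^sub>R ?f x)"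
        unfolding set_lebesgue_integral_def
        by (intro Bochner_Integration.integral_cong) (auto simp: indicator_def)
      ultimately show ?case
        using compl.IH f f_set[OF A] by (simp add: set_lebesgue_integral_def set_integrable_def)
    next
      case (union A)
      have A: "A i \<in> sets borel" for i
        using union.hyps sig by auto
      have "(LINT x:(\<Union>i. A i)|lborel. ?f x) = (\<Sum>i. (LINT x:(A i)|lborel. ?f x))"
      proof (rule lebesgue_integral_countable_add)
        show "set_integrable lborel (\<Union>i. A i) ?f"
          using A by (intro f_set) auto
        show "i \<noteq> j \<Longrightarrow> A i \<inter> A j = {}" for i j
          using union.hyps(1) by (auto simp: disjoint_family_on_def)
      qed (use A in auto)
      then show ?case using union.IH by simp
    qed
  qed
  then have "AE x in lborel. ?f x = 0"
    using f by (intro sigma_finite_measure.density_zero[OF sigma_finite_lborel]) auto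
  then show ?thesis
    by eventually_elim (auto simp: indicator_def split: if_splits)
qed

text \<open>Testing with bumps that converge to the indicator of a box shows that the integral of
  \<open>h\<close> over each box with closure in the domain is zero. Hence \<open>h\<close> vanishes
  almost everywhere on each such box, and countably many of them cover the domain.\<close>

lemma fundamental_lemma_calculus_of_variations:
  fixes h :: "'a::euclidean_space \<Rightarrow> real"
  assumes "open \<Omega>" and h: "integrable (lebesgue_on \<Omega>) h"
    and zero: "\<And>\<phi>. \<phi> \<in> test_functions \<Omega> \<Longrightarrow> (LINT x|lebesgue_on \<Omega>. h x * \<phi> x) = 0"
  shows "AE x in lebesgue_on \<Omega>. h x = 0"
proof -
  have \<Omega>: "\<Omega> \<in> sets lebesgue"
    using \<open>open \<Omega>\<close> by auto
  let ?H = "\<lambda>x. indicator \<Omega> x *\<^sub>R h x"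
  have H: "integrable lebesgue ?H"
    using h \<Omega> by (simp add: integrable_restrict_space)
  \<comment> \<open>\<open>h\<close> is only Lebesgue measurable, while the generator argument
    concerns Borel sets; a Borel representative of the zero extension replaces it.\<close>
  then obtain g where g: "g \<in> borel_measurable lborel" "AE x in lborel. ?H x = g x"
    using completion_ex_borel_measurable_real[of ?H lborel] by (auto dest: borel_measurable_integrable)
  have AE_g: "AE x in lebesgue. ?H x = g x"
    using g(2) by (rule AE_completion)
  have g_meas: "g \<in> borel_measurable lebesgue"
    using g(1) by (rule measurable_completion)
  have int_g: "integrable lborel g"
    using integrable_cong_AE_imp[OF H g_meas AE_g] integrable_completion[OF g(1)] by simp
  have box0: "(LINT x:box a b|lborel. g x) = 0" if sub: "cbox a b \<subseteq> \<Omega>" for a b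
  proof -
    have meas_bump: "box_bump a b n \<in> borel_measurable borel" for n
      using Ck_box_bump[of 0 a b n] by (simp add: borel_measurable_continuous_onI)
    have "(LINT x|lborel. g x * box_bump a b n x) = 0" for n
    proof -
      have "(LINT x|lborel. g x * box_bump a b n x) = (LINT x|lebesgue. g x * box_bump a b n x)"
        using g(1) meas_bump by (intro integral_completion[symmetric]) auto
      also have "\<dots> = (LINT x|lebesgue. indicator \<Omega> x *\<^sub>R (h x * box_bump a b n x))"
      proof (rule integral_cong_AE)
        have bump: "box_bump a b n \<in> borel_measurable lebesgue"
          using meas_bump[of n] by (intro measurable_completion) simp
        show "(\<lambda>x. g x * box_bump a b n x) \<in> borel_measurable lebesgue"
          using g_meas bump by (rule borel_measurable_times)
        show "(\<lambda>x. indicator \<Omega> x *\<^sub>R (h x * box_bump a b n x)) \<in> borel_measurable lebesgue"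
          using borel_measurable_times[OF borel_measurable_integrable[OF H] bump]
          by (simp add: mult.assoc)
        show "AE x in lebesgue. g x * box_bump a b n x = indicator \<Omega> x *\<^sub>R (h x * box_bump a b n x)"
          using AE_g by eventually_elim (simp flip: mult.assoc)
      qed
      also have "\<dots> = (LINT x|lebesgue_on \<Omega>. h x * box_bump a b n x)"
        using \<Omega> by (simp add: integral_restrict_space)
      finally show ?thesis
        using zero[OF box_bump_test_function[OF sub]] by simp
    qed
    moreover have "(\<lambda>n. LINT x|lborel. g x * box_bump a b n x) \<longlonglongrightarrow>
        (LINT x|lborel. g x * indicator (box a b) x)"
    proof (rule integral_dominated_convergence)
      show "integrable lborel (\<lambda>x. norm (g x))"
        using int_g by simp
      show "AE x in lborel. (\<lambda>n. g x * box_bump a b n x) \<longlonglongrightarrow> g x * indicator (box a b) x"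
        by (intro always_eventually allI tendsto_intros box_bump_tendsto)
      show "AE x in lborel. norm (g x * box_bump a b n x) \<le> norm (g x)" for n
        using box_bump_bounds[of a b n] by (auto simp: abs_mult intro!: always_eventually mult_right_le_one_le)
    qed (use g(1) meas_bump in auto)
    ultimately show ?thesis
      by (simp add: set_lebesgue_integral_def LIMSEQ_const_iff mult.commute)
  qed
  have AE_box: "AE x in lborel. x \<in> box a b \<longrightarrow> g x = 0" if "cbox a b \<subseteq> \<Omega>" for a b
  proof (rule AE_zero_on_box_if_box_integrals_zero[OF int_g])
    fix c d assume cd: "box c d \<subseteq> box a b"
    show "(LINT x:box c d|lborel. g x) = 0"
    \<comment> \<open>An empty open box can still have a nonempty closed box lying outside the
      domain, where \<open>box0\<close> says nothing; its integral is zero anyway.\<close>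
    proof (cases "box c d = {}")
      case False
      then have "cbox c d \<subseteq> closure (box a b)"
        using closure_mono[OF cd] by (simp add: closure_box)
      also have "\<dots> \<subseteq> cbox a b"
        by (intro closure_minimal box_subset_cbox) auto
      finally show ?thesis
        using box0 that by blast
    qed (simp add: set_lebesgue_integral_def)
  qed
  \<comment> \<open>Exceptional null sets may be united only countably often, so the cover by boxes
    is thinned out with the Lindelof property.\<close>
  define F where "F = {box a b | a b. cbox a b \<subseteq> \<Omega>}"
  have "\<Union>F = \<Omega>"
  proof
    show "\<Union>F \<subseteq> \<Omega>"
      unfolding F_def using box_subset_cbox by blast
    show "\<Omega> \<subseteq> \<Union>F"
    proof
      fix x assume "x \<in> \<Omega>"
      then obtain a b where "cbox a b \<subseteq> \<Omega>" "x \<in> box a b"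
        using open_contains_cbox[OF \<open>open \<Omega>\<close>] by metis
      then show "x \<in> \<Union>F"
        unfolding F_def by blast
    qed
  qed
  moreover have "open B" if "B \<in> F" for B
    using that by (auto simp: F_def)
  then obtain F' where F': "F' \<subseteq> F" "countable F'" "\<Union>F' = \<Union>F"
    using Lindelof[of F] by metis
  moreover have "AE x in lborel. \<forall>B\<in>F'. x \<in> B \<longrightarrow> g x = 0"
    using F'(1) AE_box by (intro AE_ball_countable[THEN iffD2, OF F'(2)]) (auto simp: F_def)
  ultimately have "AE x in lborel. x \<in> \<Omega> \<longrightarrow> g x = 0"
    by (auto elim!: eventually_mono)
  then have "AE x in lebesgue. x \<in> \<Omega> \<longrightarrow> g x = 0"
    by (rule AE_completion)
  with AE_g have "AE x in lebesgue. x \<in> \<Omega> \<longrightarrow> h x = 0"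
    by eventually_elim auto
  then show ?thesis
    using \<Omega> by (simp add: AE_restrict_space_iff)
qed

subsection \<open>Square integrable functions\<close>

lemma L2_measurable: "f \<in> L2 \<Omega> \<Longrightarrow> f \<in> borel_measurable (lebesgue_on \<Omega>)"
  by (simp add: L2_def)

lemma L2_integrable_norm_square: "f \<in> L2 \<Omega> \<Longrightarrow> integrable (lebesgue_on \<Omega>) (\<lambda>x. (norm (f x))\<^sup>2)"
  by (simp add: L2_def)

lemma L2_scaleR: "f \<in> L2 \<Omega> \<Longrightarrow> (\<lambda>x. c *\<^sub>R f x) \<in> L2 \<Omega>"
  by (auto simp: L2_def power_mult_distrib)

text \<open>By the parallelogram law the two sides differ by the square of the norm of a +
  b.\<close>

lemma norm_diff_square_le:
  fixes a b :: "'b::real_inner"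
  shows "(norm (a - b))\<^sup>2 \<le> 2 * (norm a)\<^sup>2 + 2 * (norm b)\<^sup>2"
  using zero_le_power2[of "norm (a + b)"]
  by (simp add: power2_norm_eq_inner algebra_simps inner_commute)

lemma L2_diff:
  assumes "f \<in> L2 \<Omega>" "g \<in> L2 \<Omega>"
  shows "(\<lambda>x. f x - g x) \<in> L2 \<Omega>"
proof -
  note meas[measurable] = assms[THEN L2_measurable]
  have "integrable (lebesgue_on \<Omega>) (\<lambda>x. (norm (f x - g x))\<^sup>2)"
  proof (rule Bochner_Integration.integrable_bound)
    show "integrable (lebesgue_on \<Omega>) (\<lambda>x. 2 * (norm (f x))\<^sup>2 + 2 * (norm (g x))\<^sup>2)"
      using assms by (intro Bochner_Integration.integrable_add integrable_mult_right
          L2_integrable_norm_square)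
  qed (auto simp: norm_diff_square_le)
  then show ?thesis
    by (simp add: L2_def meas borel_measurable_diff)
qed

lemma L2_integrable_inner:
  assumes "f \<in> L2 \<Omega>" "g \<in> L2 \<Omega>"
  shows "integrable (lebesgue_on \<Omega>) (\<lambda>x. f x \<bullet> g x)"
proof (rule Bochner_Integration.integrable_bound)
  note meas[measurable] = assms[THEN L2_measurable]
  show "(\<lambda>x. f x \<bullet> g x) \<in> borel_measurable (lebesgue_on \<Omega>)"
    by measurable
  show "integrable (lebesgue_on \<Omega>) (\<lambda>x. (norm (f x))\<^sup>2 + (norm (g x))\<^sup>2)"
    using assms by (intro Bochner_Integration.integrable_add L2_integrable_norm_square)
  have "\<bar>a \<bullet> b\<bar> \<le> (norm a)\<^sup>2 + (norm b)\<^sup>2" for a b :: 'b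
  proof -
    have "0 \<le> (norm a - norm b)\<^sup>2" "0 \<le> norm a * norm b"
      by simp_all
    then have "norm a * norm b \<le> (norm a)\<^sup>2 + (norm b)\<^sup>2"
      unfolding power2_diff by linarith
    then show ?thesis
      using Cauchy_Schwarz_ineq2[of a b] by linarith
  qed
  then show "AE x in lebesgue_on \<Omega>. norm (f x \<bullet> g x) \<le> norm ((norm (f x))\<^sup>2 + (norm (g x))\<^sup>2)"
    by simp
qed

lemma L2_component:
  assumes "f \<in> L2 \<Omega>" "b \<in> Basis"
  shows "(\<lambda>x. f x \<bullet> b) \<in> L2 \<Omega>"
proof -
  note meas[measurable] = L2_measurable[OF assms(1)]
  have "integrable (lebesgue_on \<Omega>) (\<lambda>x. (norm (f x \<bullet> b))\<^sup>2)"
    by (rule Bochner_Integration.integrable_bound[OF L2_integrable_norm_square[OF assms(1)]])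
      (use power_mono[OF Basis_le_norm[OF assms(2)], of _ 2] in simp_all)
  then show ?thesis
    using meas by (simp add: L2_def)
qed

lemma L2_integrable:
  fixes f :: "'a::euclidean_space \<Rightarrow> real"
  assumes "\<Omega> \<in> lmeasurable" "f \<in> L2 \<Omega>"
  shows "integrable (lebesgue_on \<Omega>) f"
proof -
  interpret finite_measure "lebesgue_on \<Omega>"
    using assms(1) by (rule finite_measure_lebesgue_on)
  show ?thesis
    by (rule square_integrable_imp_integrable) (use assms(2) in \<open>simp_all add: L2_def\<close>)
qed

lemma L2_inner_commute: "L2_inner \<Omega> f g = L2_inner \<Omega> g f"
  by (simp add: L2_inner_def inner_commute)

lemma L2_inner_self_nonneg: "0 \<le> L2_inner \<Omega> f f"
  by (simp add: L2_inner_def)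

lemma L2_inner_diff_left:
  assumes "f \<in> L2 \<Omega>" "g \<in> L2 \<Omega>" "h \<in> L2 \<Omega>"
  shows "L2_inner \<Omega> (\<lambda>x. f x - g x) h = L2_inner \<Omega> f h - L2_inner \<Omega> g h"
  using assms by (simp add: L2_inner_def inner_diff_left L2_integrable_inner)

lemma L2_inner_diff_right:
  assumes "f \<in> L2 \<Omega>" "g \<in> L2 \<Omega>" "h \<in> L2 \<Omega>"
  shows "L2_inner \<Omega> h (\<lambda>x. f x - g x) = L2_inner \<Omega> h f - L2_inner \<Omega> h g"
  using assms by (simp add: L2_inner_def inner_diff_right L2_integrable_inner)

lemma L2_inner_scaleR_left: "L2_inner \<Omega> (\<lambda>x. c *\<^sub>R f x) g = c * L2_inner \<Omega> f g"
  by (simp add: L2_inner_def)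

lemma L2_inner_scaleR_right: "L2_inner \<Omega> f (\<lambda>x. c *\<^sub>R g x) = c * L2_inner \<Omega> f g"
  by (simp add: L2_inner_def)

lemma L2_inner_cong_AE:
  assumes "f \<in> L2 \<Omega>" "f' \<in> L2 \<Omega>" "g \<in> L2 \<Omega>" "g' \<in> L2 \<Omega>"
    and "AE x in lebesgue_on \<Omega>. f x = f' x" "AE x in lebesgue_on \<Omega>. g x = g' x"
  shows "L2_inner \<Omega> f g = L2_inner \<Omega> f' g'"
  unfolding L2_inner_def
proof (rule integral_cong_AE)
  show "AE x in lebesgue_on \<Omega>. f x \<bullet> g x = f' x \<bullet> g' x"
    using assms(5,6) by eventually_elim simp
qed (use assms(1-4) in \<open>auto intro: borel_measurable_integrable L2_integrable_inner\<close>)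

lemma L2_inner_diff_self_le:
  assumes "f \<in> L2 \<Omega>" "g \<in> L2 \<Omega>"
  shows "L2_inner \<Omega> (\<lambda>x. f x - g x) (\<lambda>x. f x - g x) \<le> 2 * L2_inner \<Omega> f f + 2 * L2_inner \<Omega> g g"
proof -
  have "(LINT x|lebesgue_on \<Omega>. (f x - g x) \<bullet> (f x - g x)) \<le>
      (LINT x|lebesgue_on \<Omega>. 2 * (f x \<bullet> f x) + 2 * (g x \<bullet> g x))"
    using assms by (intro integral_mono L2_integrable_inner L2_diff
        Bochner_Integration.integrable_add integrable_mult_right)
      (simp_all add: norm_diff_square_le flip: power2_norm_eq_inner)
  also have "\<dots> = 2 * L2_inner \<Omega> f f + 2 * L2_inner \<Omega> g g"
    using assms by (simp add: L2_inner_def L2_integrable_inner)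
  finally show ?thesis by (simp add: L2_inner_def)
qed

lemma L2_inner_self_eq_0_imp_AE:
  assumes "f \<in> L2 \<Omega>" "L2_inner \<Omega> f f \<le> 0"
  shows "AE x in lebesgue_on \<Omega>. f x = 0"
proof -
  have "(LINT x|lebesgue_on \<Omega>. f x \<bullet> f x) = 0"
    using assms(2) by (intro antisym) (auto simp: L2_inner_def)
  then have "AE x in lebesgue_on \<Omega>. f x \<bullet> f x = 0"
    using L2_integrable_inner[OF assms(1,1)] by (subst (asm) integral_nonneg_eq_0_iff_AE) auto
  then show ?thesis by simp
qed

subsection \<open>Weak gradients and Sobolev spaces\<close>

text \<open>These facts are all that the choice in \<open>wgrad\<close> provides; anything further
  about the representative holds almost everywhere, through uniqueness.\<close>

lemma H1_D:
  assumes "u \<in> H1 \<Omega>"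
  shows "u \<in> L2 \<Omega>" "wgrad \<Omega> u \<in> L2 \<Omega>" "has_weak_gradient \<Omega> u (wgrad \<Omega> u)"
proof -
  have "\<exists>g. g \<in> L2 \<Omega> \<and> has_weak_gradient \<Omega> u g"
    using assms by (auto simp: H1_def)
  from someI_ex[OF this] show "wgrad \<Omega> u \<in> L2 \<Omega>" "has_weak_gradient \<Omega> u (wgrad \<Omega> u)"
    by (simp_all add: wgrad_def)
  show "u \<in> L2 \<Omega>"
    using assms by (simp add: H1_def)
qed

lemma H10_imp_H1: "u \<in> H10 \<Omega> \<Longrightarrow> u \<in> H1 \<Omega>"
  by (simp add: H10_def)

lemma has_weak_gradient_diff:
  assumes \<Omega>: "\<Omega> \<in> sets lebesgue"
    and L2: "u \<in> L2 \<Omega>" "v \<in> L2 \<Omega>" "g \<in> L2 \<Omega>" "h \<in> L2 \<Omega>"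
    and "has_weak_gradient \<Omega> u g" "has_weak_gradient \<Omega> v h"
  shows "has_weak_gradient \<Omega> (\<lambda>x. u x - v x) (\<lambda>x. g x - h x)"
  unfolding has_weak_gradient_def
proof (intro ballI)
  fix \<phi> and b :: 'a
  assume \<phi>: "\<phi> \<in> test_functions \<Omega>" and b: "b \<in> Basis"
  have D: "(\<lambda>x. frechet_derivative \<phi> (at x) b) \<in> L2 \<Omega>"
    using L2_component[OF gradient_test_function_in_L2[OF \<Omega> \<phi>] b] b
    by (simp add: gradient_inner_Basis)
  note \<phi>_L2 = test_function_in_L2[OF \<Omega> \<phi>]
  have "integrable (lebesgue_on \<Omega>) (\<lambda>x. w x * frechet_derivative \<phi> (at x) b)" if "w \<in> L2 \<Omega>" for w
    using L2_integrable_inner[OF that D] by simp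
  moreover have "integrable (lebesgue_on \<Omega>) (\<lambda>x. (k x \<bullet> b) * \<phi> x)" if "k \<in> L2 \<Omega>" for k
    using L2_integrable_inner[OF L2_component[OF that b] \<phi>_L2] by simp
  ultimately show "(LINT x|lebesgue_on \<Omega>. (u x - v x) * frechet_derivative \<phi> (at x) b) =
      - (LINT x|lebesgue_on \<Omega>. ((g x - h x) \<bullet> b) * \<phi> x)"
    using assms(6,7) \<phi> b L2 by (simp add: left_diff_distrib inner_diff_left has_weak_gradient_def)
qed

context
  fixes \<Omega> :: "'a::euclidean_space set"
  assumes op: "open \<Omega>" and bd: "bounded \<Omega>"
begin

lemma lebesgue_\<Omega>: "\<Omega> \<in> sets lebesgue"
  using op by auto

text \<open>Both candidates give the same integral against every test function, so the fundamental
  lemma applies to each component of their difference. Boundedness of the domain makes these square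
  integrable components integrable.\<close>

lemma weak_gradient_unique:
  assumes "g \<in> L2 \<Omega>" "h \<in> L2 \<Omega>" "has_weak_gradient \<Omega> u g" "has_weak_gradient \<Omega> u h"
  shows "AE x in lebesgue_on \<Omega>. g x = h x"
proof -
  have "AE x in lebesgue_on \<Omega>. g x \<bullet> b - h x \<bullet> b = 0" if b: "b \<in> Basis" for b
  proof (rule fundamental_lemma_calculus_of_variations[OF op])
    have L2: "(\<lambda>x. g x \<bullet> b) \<in> L2 \<Omega>" "(\<lambda>x. h x \<bullet> b) \<in> L2 \<Omega>"
      using assms b by (simp_all add: L2_component)
    show "integrable (lebesgue_on \<Omega>) (\<lambda>x. g x \<bullet> b - h x \<bullet> b)"
      by (intro L2_integrable lmeasurable_open bd op L2_diff L2)
    fix \<phi> assume \<phi>: "\<phi> \<in> test_functions \<Omega>"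
    have "integrable (lebesgue_on \<Omega>) (\<lambda>x. (g x \<bullet> b) * \<phi> x)"
      "integrable (lebesgue_on \<Omega>) (\<lambda>x. (h x \<bullet> b) * \<phi> x)"
      using L2_integrable_inner[OF L2(1) test_function_in_L2[OF lebesgue_\<Omega> \<phi>]]
        L2_integrable_inner[OF L2(2) test_function_in_L2[OF lebesgue_\<Omega> \<phi>]] by simp_all
    moreover have "(LINT x|lebesgue_on \<Omega>. (g x \<bullet> b) * \<phi> x) = (LINT x|lebesgue_on \<Omega>. (h x \<bullet> b) * \<phi> x)"
      using assms(3)[unfolded has_weak_gradient_def, rule_format, OF \<phi> b]
        assms(4)[unfolded has_weak_gradient_def, rule_format, OF \<phi> b] by linarith
    ultimately show "(LINT x|lebesgue_on \<Omega>. (g x \<bullet> b - h x \<bullet> b) * \<phi> x) = 0"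
      by (simp add: left_diff_distrib)
  qed
  then have "AE x in lebesgue_on \<Omega>. \<forall>b\<in>Basis. g x \<bullet> b - h x \<bullet> b = 0"
    by (intro AE_finite_allI) auto
  then show ?thesis
    by eventually_elim (auto intro: euclidean_eqI)
qed

text \<open>The difference of the chosen gradients is a weak gradient of the difference, hence
  agrees almost everywhere with the representative chosen for it.\<close>

lemma
  assumes "u \<in> H1 \<Omega>" "v \<in> H1 \<Omega>"
  shows H1_diff: "(\<lambda>x. u x - v x) \<in> H1 \<Omega>"
    and wgrad_diff: "AE x in lebesgue_on \<Omega>.
      wgrad \<Omega> (\<lambda>x. u x - v x) x = wgrad \<Omega> u x - wgrad \<Omega> v x"
proof -
  note D = H1_D[OF assms(1)] H1_D[OF assms(2)]
  have weak: "has_weak_gradient \<Omega> (\<lambda>x. u x - v x) (\<lambda>x. wgrad \<Omega> u x - wgrad \<Omega> v x)"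
    by (intro has_weak_gradient_diff lebesgue_\<Omega> D)
  have L2: "(\<lambda>x. wgrad \<Omega> u x - wgrad \<Omega> v x) \<in> L2 \<Omega>"
    by (intro L2_diff D)
  show H1: "(\<lambda>x. u x - v x) \<in> H1 \<Omega>"
    unfolding H1_def using L2 weak L2_diff[OF D(1,4)] by blast
  show "AE x in lebesgue_on \<Omega>. wgrad \<Omega> (\<lambda>x. u x - v x) x = wgrad \<Omega> u x - wgrad \<Omega> v x"
    using weak_gradient_unique[OF H1_D(2)[OF H1] L2 H1_D(3)[OF H1] weak] .
qed

lemma
  assumes "\<phi> \<in> test_functions \<Omega>"
  shows test_function_in_H1: "\<phi> \<in> H1 \<Omega>"
    and wgrad_test_function: "AE x in lebesgue_on \<Omega>. wgrad \<Omega> \<phi> x = gradient \<phi> x"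
proof -
  note weak = has_weak_gradient_test_function[OF lebesgue_\<Omega> assms]
  note L2 = gradient_test_function_in_L2[OF lebesgue_\<Omega> assms]
  show H1: "\<phi> \<in> H1 \<Omega>"
    unfolding H1_def using L2 weak test_function_in_L2[OF lebesgue_\<Omega> assms] by blast
  show "AE x in lebesgue_on \<Omega>. wgrad \<Omega> \<phi> x = gradient \<phi> x"
    using weak_gradient_unique[OF H1_D(2)[OF H1] L2 H1_D(3)[OF H1] weak] .
qed

lemma H1_norm_square:
  "(H1_norm \<Omega> u)\<^sup>2 = L2_inner \<Omega> u u + L2_inner \<Omega> (wgrad \<Omega> u) (wgrad \<Omega> u)"
  by (simp add: H1_norm_def L2_inner_self_nonneg)

text \<open>A squared stand-in for the triangle inequality; the factor 2 is harmless where both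
  norms tend to 0.\<close>

lemma H1_norm_diff_square_le:
  assumes "u \<in> H1 \<Omega>" "v \<in> H1 \<Omega>"
  shows "(H1_norm \<Omega> (\<lambda>x. u x - v x))\<^sup>2 \<le> 2 * (H1_norm \<Omega> u)\<^sup>2 + 2 * (H1_norm \<Omega> v)\<^sup>2"
proof -
  note D = H1_D[OF assms(1)] H1_D[OF assms(2)] H1_D[OF H1_diff[OF assms]]
  let ?d = "\<lambda>x. wgrad \<Omega> u x - wgrad \<Omega> v x"
  have "L2_inner \<Omega> (wgrad \<Omega> (\<lambda>x. u x - v x)) (wgrad \<Omega> (\<lambda>x. u x - v x)) = L2_inner \<Omega> ?d ?d"
    by (intro L2_inner_cong_AE L2_diff D wgrad_diff assms)
  then show ?thesis
    using L2_inner_diff_self_le[OF D(1,4)] L2_inner_diff_self_le[OF D(2,5)]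
    by (simp add: H1_norm_square)
qed

lemma H10_diff:
  assumes "u \<in> H10 \<Omega>" "v \<in> H10 \<Omega>"
  shows "(\<lambda>x. u x - v x) \<in> H10 \<Omega>"
proof -
  obtain \<phi> where \<phi>: "\<And>n. \<phi> n \<in> test_functions \<Omega>"
    "(\<lambda>n. H1_norm \<Omega> (\<lambda>x. u x - \<phi> n x)) \<longlonglongrightarrow> 0"
    using assms(1) unfolding H10_def by blast
  obtain \<psi> where \<psi>: "\<And>n. \<psi> n \<in> test_functions \<Omega>"
    "(\<lambda>n. H1_norm \<Omega> (\<lambda>x. v x - \<psi> n x)) \<longlonglongrightarrow> 0"
    using assms(2) unfolding H10_def by blast
  note H1 = assms[THEN H10_imp_H1]
  let ?\<chi> = "\<lambda>n x. \<phi> n x - \<psi> n x"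
  let ?e = "\<lambda>n. H1_norm \<Omega> (\<lambda>x. u x - v x - ?\<chi> n x)"
  let ?b = "\<lambda>n. 2 * (H1_norm \<Omega> (\<lambda>x. u x - \<phi> n x))\<^sup>2 + 2 * (H1_norm \<Omega> (\<lambda>x. v x - \<psi> n x))\<^sup>2"
  have bound: "(?e n)\<^sup>2 \<le> ?b n" for n
    using H1_norm_diff_square_le[OF H1_diff[OF H1(1) test_function_in_H1[OF \<phi>(1)[of n]]]
        H1_diff[OF H1(2) test_function_in_H1[OF \<psi>(1)[of n]]]]
    by (simp add: algebra_simps)
  have lim: "?b \<longlonglongrightarrow> 2 * 0\<^sup>2 + 2 * 0\<^sup>2"
    by (intro tendsto_intros \<phi> \<psi>)
  have "(\<lambda>n. (?e n)\<^sup>2) \<longlonglongrightarrow> 0"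
  proof (rule tendsto_sandwich[OF _ _ tendsto_const])
    show "\<forall>\<^sub>F n in sequentially. 0 \<le> (?e n)\<^sup>2"
      by simp
    show "\<forall>\<^sub>F n in sequentially. (?e n)\<^sup>2 \<le> ?b n"
      using bound by (rule always_eventually[OF allI])
    show "?b \<longlonglongrightarrow> 0"
      using lim by simp
  qed
  then have "?e \<longlonglongrightarrow> 0"
    by simp
  then show ?thesis
    using H1_diff[OF H1] test_function_diff[OF \<phi>(1) \<psi>(1)] unfolding H10_def
    by (auto intro!: exI[of _ ?\<chi>])
qed

text \<open>If the gradient of \<open>u\<close> vanishes, then that of an approximating test
  function is, up to sign, the gradient of the error. The Poincare inequality thus makes the test
  function itself small, and with it \<open>u\<close>.\<close>

lemma H10_zero_gradient_imp_zero:
  assumes u: "u \<in> H10 \<Omega>" and grad0: "AE x in lebesgue_on \<Omega>. wgrad \<Omega> u x = 0"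
  shows "AE x in lebesgue_on \<Omega>. u x = 0"
proof -
  obtain \<phi> where \<phi>: "\<And>n. \<phi> n \<in> test_functions \<Omega>"
    "(\<lambda>n. H1_norm \<Omega> (\<lambda>x. u x - \<phi> n x)) \<longlonglongrightarrow> 0"
    using u unfolding H10_def by blast
  obtain R where R: "\<And>x. x \<in> \<Omega> \<Longrightarrow> norm x \<le> R"
    using bd by (auto simp: bounded_iff)
  note H1 = H10_imp_H1[OF u]
  let ?e = "\<lambda>n. H1_norm \<Omega> (\<lambda>x. u x - \<phi> n x)"
  \<comment> \<open>The constant comes from splitting \<open>u\<close> into error and test function:
    2 for the error, and 2 times the Poincare constant 4 R^2 for the test function.\<close>
  have "L2_inner \<Omega> u u \<le> (2 + 8 * R\<^sup>2) * (?e n)\<^sup>2" for n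
  proof -
    let ?d = "\<lambda>x. u x - \<phi> n x"
    note \<phi>H1 = test_function_in_H1[OF \<phi>(1)[of n]]
    note dH1 = H1_diff[OF H1 \<phi>H1]
    note grad_L2 = gradient_test_function_in_L2[OF lebesgue_\<Omega> \<phi>(1)[of n]]
    have "AE x in lebesgue_on \<Omega>. wgrad \<Omega> ?d x = (-1) *\<^sub>R gradient (\<phi> n) x"
      using wgrad_diff[OF H1 \<phi>H1] wgrad_test_function[OF \<phi>(1)[of n]] grad0
      by eventually_elim simp
    then have "L2_inner \<Omega> (wgrad \<Omega> ?d) (wgrad \<Omega> ?d) =
        L2_inner \<Omega> (\<lambda>x. (-1) *\<^sub>R gradient (\<phi> n) x) (\<lambda>x. (-1) *\<^sub>R gradient (\<phi> n) x)"
      by (intro L2_inner_cong_AE L2_scaleR H1_D(2)[OF dH1] grad_L2)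
    then have "L2_inner \<Omega> (gradient (\<phi> n)) (gradient (\<phi> n)) \<le> (?e n)\<^sup>2"
      by (simp only: L2_inner_scaleR_left L2_inner_scaleR_right H1_norm_square)
        (simp add: L2_inner_self_nonneg)
    then have "L2_inner \<Omega> (\<phi> n) (\<phi> n) \<le> 4 * R\<^sup>2 * (?e n)\<^sup>2"
      using Poincare_test_function[OF lebesgue_\<Omega> R \<phi>(1)[of n]]
      by (meson mult_left_mono mult_nonneg_nonneg order_trans zero_le_numeral zero_le_power2)
    moreover have "L2_inner \<Omega> ?d ?d \<le> (?e n)\<^sup>2"
      by (simp add: H1_norm_square L2_inner_self_nonneg)
    moreover have "L2_inner \<Omega> u u \<le> 2 * L2_inner \<Omega> ?d ?d + 2 * L2_inner \<Omega> (\<phi> n) (\<phi> n)"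
      using L2_inner_diff_self_le[OF H1_D(1)[OF dH1]
          L2_scaleR[OF test_function_in_L2[OF lebesgue_\<Omega> \<phi>(1)[of n]], of "-1"]]
      by (simp add: L2_inner_def)
    ultimately show ?thesis
      by (simp add: algebra_simps)
  qed
  moreover have "(\<lambda>n. (2 + 8 * R\<^sup>2) * (?e n)\<^sup>2) \<longlonglongrightarrow> (2 + 8 * R\<^sup>2) * 0\<^sup>2"
    by (intro tendsto_intros \<phi>)
  ultimately have "L2_inner \<Omega> u u \<le> (2 + 8 * R\<^sup>2) * 0\<^sup>2"
    by (intro LIMSEQ_le_const) auto
  then show ?thesis
    using L2_inner_self_eq_0_imp_AE[OF H1_D(1)[OF H1]] by simp
qed

end

subsection \<open>Equivalence of the two problems\<close>

theorem proposition1: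
  fixes \<Omega> :: "(real ^ 'n) set"
    and f :: "(real ^ 'n \<Rightarrow> real) \<Rightarrow> real"
    and u u' :: "real ^ 'n \<Rightarrow> real"
    and \<sigma> :: "real ^ 'n \<Rightarrow> real ^ 'n"
  assumes "CARD('n) = 2 \<or> CARD('n) = 3"
    and "bounded_convex_polyhedral_domain \<Omega>"
    and "f \<in> Hminus1 \<Omega>"
    and "is_arg_min (\<lambda>v. 1/2 * (LINT x|lebesgue_on \<Omega>. (norm (wgrad \<Omega> v x))\<^sup>2) - f v)
           (\<lambda>v. v \<in> H10 \<Omega>) u"
    and "u' \<in> H10 \<Omega>" and "\<sigma> \<in> L2 \<Omega>"
    and "\<forall>v\<in>H10 \<Omega>. \<forall>\<tau>\<in>L2 \<Omega>.
           L2_inner \<Omega> \<sigma> \<tau> +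
           L2_inner \<Omega> (\<lambda>x. \<sigma> x - 2 *\<^sub>R wgrad \<Omega> u' x) (\<lambda>x. \<tau> x - 2 *\<^sub>R wgrad \<Omega> v x)
           = 2 * f v"
  shows "(AE x in lebesgue_on \<Omega>. u' x = u x) \<and> (AE x in lebesgue_on \<Omega>. \<sigma> x = wgrad \<Omega> u x)"
proof -
  let ?G = "wgrad \<Omega>" and ?ip = "L2_inner \<Omega>"
  define w where "w x = u x - u' x" for x
  have \<Omega>: "open \<Omega>" "bounded \<Omega>"
    using assms(2) by (simp_all add: bounded_convex_polyhedral_domain_def)
  have u: "u \<in> H10 \<Omega>"
    using assms(4) by (simp add: is_arg_min_def)
  have w: "w \<in> H10 \<Omega>"
    unfolding w_def using H10_diff[OF \<Omega> u assms(5)] .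
  \<comment> \<open>Zero is obtained as \<open>u'\<close> minus itself; the same device later shows
    that its chosen gradient vanishes almost everywhere.\<close>
  have zero: "(\<lambda>_. 0) \<in> H10 \<Omega>"
    using H10_diff[OF \<Omega> assms(5,5)] by simp
  note H1 = u[THEN H10_imp_H1] assms(5)[THEN H10_imp_H1]
  note L2 = assms(6) H1[THEN H1_D(2)] w[THEN H10_imp_H1, THEN H1_D(2)]
    zero[THEN H10_imp_H1, THEN H1_D(2)]
  have grad_w: "AE x in lebesgue_on \<Omega>. ?G w x = ?G u x - ?G u' x"
    unfolding w_def by (rule wgrad_diff[OF \<Omega> H1])
  have f_add: "f (\<lambda>x. v x + v' x) = f v + f v'" if "v \<in> H10 \<Omega>" "v' \<in> H10 \<Omega>" for v v'
    using assms(3) that by (simp add: Hminus1_def)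
  have f_0: "f (\<lambda>_. 0) = 0"
    using f_add[OF zero zero] by simp
  have f_w: "f w = f u - f u'"
    using f_add[OF w assms(5)] by (simp add: w_def)

  \<comment> \<open>For v = 0 the left side of the variational equation is twice the inner product
    of \<sigma> - grad u' with \<tau>. Choosing \<tau> to be that very difference turns it into a
    squared norm.\<close>
  let ?\<tau> = "\<lambda>x. \<sigma> x - ?G u' x"
  have \<tau>: "?\<tau> \<in> L2 \<Omega>"
    by (intro L2_diff L2)
  have "AE x in lebesgue_on \<Omega>. ?G (\<lambda>_. 0) x = 0"
    using wgrad_diff[OF \<Omega> H1(2,2)] by simp
  then have "AE x in lebesgue_on \<Omega>. ?\<tau> x - 2 *\<^sub>R ?G (\<lambda>_. 0) x = ?\<tau> x"
    by eventually_elim simp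
  then have "?ip (\<lambda>x. \<sigma> x - 2 *\<^sub>R ?G u' x) (\<lambda>x. ?\<tau> x - 2 *\<^sub>R ?G (\<lambda>_. 0) x) =
      ?ip (\<lambda>x. \<sigma> x - 2 *\<^sub>R ?G u' x) ?\<tau>"
    by (intro L2_inner_cong_AE L2_diff L2_scaleR L2) auto
  also have "\<dots> = ?ip \<sigma> ?\<tau> - 2 * ?ip (?G u') ?\<tau>"
    by (simp add: L2_inner_diff_left L2_inner_scaleR_left L2_scaleR L2 \<tau>)
  finally have "2 * ?ip \<sigma> ?\<tau> - 2 * ?ip (?G u') ?\<tau> = 0"
    using assms(7)[rule_format, OF zero \<tau>] f_0 by simp
  then have "?ip ?\<tau> ?\<tau> = 0"
    using L2_inner_diff_left[OF L2(1) L2(3) \<tau>] by simp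
  then have "AE x in lebesgue_on \<Omega>. ?\<tau> x = 0"
    by (intro L2_inner_self_eq_0_imp_AE \<tau>) simp
  then have \<sigma>_eq: "AE x in lebesgue_on \<Omega>. \<sigma> x = ?G u' x"
    by eventually_elim simp

  \<comment> \<open>With \<tau> = 0 and v = \<open>w\<close> the equation reads -2 (\<sigma> - 2
    grad u', grad w) = 2 f(w), and inserting \<sigma> = grad u' makes the left side 2 (grad u', grad
    w).\<close>
  have "(\<lambda>_. 0 :: real ^ 'n) \<in> L2 \<Omega>"
    using L2_scaleR[OF L2(1), of 0] by simp
  then have "?ip \<sigma> (\<lambda>_. 0) + ?ip (\<lambda>x. \<sigma> x - 2 *\<^sub>R ?G u' x) (\<lambda>x. 0 - 2 *\<^sub>R ?G w x) = 2 * f w"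
    using assms(7)[rule_format, OF w] by blast
  moreover have "?ip \<sigma> (\<lambda>_. 0) = 0"
    by (simp add: L2_inner_def)
  moreover have "?ip (\<lambda>x. \<sigma> x - 2 *\<^sub>R ?G u' x) (\<lambda>x. 0 - 2 *\<^sub>R ?G w x) =
      - 2 * (?ip \<sigma> (?G w) - 2 * ?ip (?G u') (?G w))"
    using L2_inner_scaleR_right[of \<Omega> "\<lambda>x. \<sigma> x - 2 *\<^sub>R ?G u' x" "-2" "?G w"]
    by (simp add: L2_inner_diff_left L2_inner_scaleR_left L2_scaleR L2)
  moreover have "?ip \<sigma> (?G w) = ?ip (?G u') (?G w)"
    by (intro L2_inner_cong_AE L2 \<sigma>_eq) simp
  ultimately have weak: "?ip (?G u') (?G w) = f w"
    by simp

  have "?ip (?G u') (?G w) = ?ip (?G u') (\<lambda>x. ?G u x - ?G u' x)"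
    by (intro L2_inner_cong_AE L2_diff L2 grad_w) simp
  also have "\<dots> = ?ip (?G u') (?G u) - ?ip (?G u') (?G u')"
    by (intro L2_inner_diff_right L2)
  finally have cross: "f w = ?ip (?G u') (?G u) - ?ip (?G u') (?G u')"
    using weak by simp
  have "?ip (?G w) (?G w) = ?ip (\<lambda>x. ?G u x - ?G u' x) (\<lambda>x. ?G u x - ?G u' x)"
    by (intro L2_inner_cong_AE L2_diff L2 grad_w)
  also have "\<dots> = ?ip (?G u) (?G u) - 2 * ?ip (?G u') (?G u) + ?ip (?G u') (?G u')"
    using L2_inner_commute[of \<Omega> "?G u" "?G u'"]
    by (simp add: L2_inner_diff_left L2_inner_diff_right L2_diff L2)
  finally have "1/2 * ?ip (?G w) (?G w) =
      (1/2 * ?ip (?G u) (?G u) - f u) - (1/2 * ?ip (?G u') (?G u') - f u')"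
    using cross f_w by simp
  \<comment> \<open>Minimality enters through comparison with the single competitor
    \<open>u'\<close>.\<close>
  moreover have "1/2 * ?ip (?G u) (?G u) - f u \<le> 1/2 * ?ip (?G u') (?G u') - f u'"
    using assms(4,5) by (auto simp: is_arg_min_def L2_inner_def power2_norm_eq_inner not_less)
  ultimately have "AE x in lebesgue_on \<Omega>. ?G w x = 0"
    by (intro L2_inner_self_eq_0_imp_AE L2) simp
  moreover from this have "AE x in lebesgue_on \<Omega>. w x = 0"
    by (rule H10_zero_gradient_imp_zero[OF \<Omega> w])
  then have "AE x in lebesgue_on \<Omega>. u' x = u x"
    by eventually_elim (simp add: w_def)
  \<comment> \<open>Here \<open>calculation(1)\<close> is grad w = 0, so that \<sigma> = grad u' =
    grad u - grad w = grad u almost everywhere.\<close>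
  moreover have "AE x in lebesgue_on \<Omega>. \<sigma> x = ?G u x"
    using calculation(1) grad_w \<sigma>_eq by eventually_elim simp
  ultimately show ?thesis
    by blast
qed

end
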